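(* Let $d\ge 2$, let $\Lambda\subseteq\tilde{\mathcal K}^d$ be a lattice and let $\mathbf v^{(1)},\dots,\mathbf v^{(d)}\in\Lambda$ be a set of successive minima vectors for $\Lambda$. Then $\Lambda$ is spanned over $\mathcal R$ by $\mathbf v^{(1)},\dots,\mathbf v^{(d)}$.
   Context: Let $q$ be a prime power, $\mathcal R=\mathbb F_q[x]$, $\mathcal K=\mathbb F_q(x)$, and $\tilde{\mathcal K}=\mathbb F_q((x^{-1}))$, with the absolute value $|\cdot|$ extending $|f|=q^{\deg f}$ for nonzero $f\in\mathcal R$ (and $|0|=0$). On $\tilde{\mathcal K}^d$ use the norm $\|\mathbf v\|=\max_i|v_i|$. A lattice in $\tilde{\mathcal K}^d$ is a set $\Lambda=g\mathcal R^d$ with $g\in\mathrm{GL}_d(\tilde{\mathcal K})$. For $i=1,\dots,d$, the $i$-th successive minimum is $\lambda_i(\Lambda)=\min\{r>0:\text{ there exist } i \text{ linearly independent vectors in }\Lambda\text{ of norm}\le r\}$ (linear independence over $\tilde{\mathcal K}$). Linearly independent vectors $\mathbf v^{(1)},\dots,\mathbf v^{(d)}\in\Lambda$ form a set of successive minima vectors for $\Lambda$ if $\|\mathbf v^{(i)}\|=\lambda_i(\Lambda)$ for each $i=1,\dots,d$. *)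

theory Defs
  imports
    "HOL-Analysis.Analysis"
    "HOL-Computational_Algebra.Formal_Laurent_Series"
begin

text \<open>
  The finite field with \<open>q\<close> elements is a type \<open>'a\<close> of sort \<open>{field, finite}\<close>, with
  \<open>q = CARD('a)\<close>.  The field of Laurent series in \<open>1/x\<close> over it is \<open>'a fls\<close>: the formal
  variable \<open>fls_X\<close> of the library plays the role of \<open>1/x\<close>, so \<open>x\<close> itself is \<open>fls_X_inv\<close>.
  The polynomial ring in \<open>x\<close> is \<open>'a poly\<close>, embedded by substituting \<open>fls_X_inv\<close>.
\<close>

definition of_polynomial :: "'a::field poly \<Rightarrow> 'a fls" where
  "of_polynomial p = poly (map_poly fls_const p) fls_X_inv"

text \<open>
  The order of vanishing at infinity of a series in \<open>1/x\<close> is its \<open>fls_subdegree\<close>, which on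
  polynomials is minus the degree (see \<open>fls_abs_of_polynomial\<close> below).
\<close>

definition fls_abs :: "'a::{field,finite} fls \<Rightarrow> real" where
  "fls_abs f = (if f = 0 then 0 else real CARD('a) powi (- fls_subdegree f))"

definition vec_norm :: "'a::{field,finite} fls ^ 'n \<Rightarrow> real" where
  "vec_norm v = Max (range (\<lambda>i. fls_abs (v $ i)))"

definition is_lattice :: "('a::field fls ^ 'n) set \<Rightarrow> bool" where
  "is_lattice \<Lambda> \<longleftrightarrow>
     (\<exists>g :: 'a fls ^ 'n ^ 'n. invertible g \<and>
        \<Lambda> = range (\<lambda>p :: 'a poly ^ 'n. g *v (\<chi> i. of_polynomial (p $ i))))"

text \<open>
  \<open>vec.independent\<close> is linear independence over \<open>'a fls\<close>.  \<open>LEAST\<close> is the minimum of a set of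
  reals; it is meaningful only where that minimum exists, as for lattices and
  \<open>1 \<le> i \<le> CARD('n)\<close>.
\<close>

definition succ_min :: "('a::{field,finite} fls ^ 'n) set \<Rightarrow> nat \<Rightarrow> real" where
  "succ_min \<Lambda> i =
     (LEAST r. r > 0 \<and>
        (\<exists>S \<subseteq> \<Lambda>. finite S \<and> card S = i \<and> vec.independent S \<and> (\<forall>v\<in>S. vec_norm v \<le> r)))"

text \<open>
  Vectors are numbered from 1.  Independence of the family \<open>v\<close> (as opposed to its set of values)
  includes injectivity.
\<close>

definition succ_min_vectors ::
  "('a::{field,finite} fls ^ 'n) set \<Rightarrow> (nat \<Rightarrow> 'a fls ^ 'n) \<Rightarrow> bool" where
  "succ_min_vectors \<Lambda> v \<longleftrightarrow>
     (\<forall>i\<in>{1..CARD('n)}. v i \<in> \<Lambda>) \<and>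
     inj_on v {1..CARD('n)} \<and> vec.independent (v ` {1..CARD('n)}) \<and>
     (\<forall>i\<in>{1..CARD('n)}. vec_norm (v i) = succ_min \<Lambda> i)"

definition poly_scale :: "'a::field poly \<Rightarrow> 'a fls ^ 'n \<Rightarrow> 'a fls ^ 'n" where
  "poly_scale p v = of_polynomial p *s v"

lemma of_polynomial_0 [simp]: "of_polynomial 0 = 0"
  by (simp add: of_polynomial_def)

lemma of_polynomial_pCons:
  "of_polynomial (pCons a p) = fls_const a + fls_X_inv * of_polynomial p"
  by (cases "a = 0 \<and> p = 0") (auto simp: of_polynomial_def map_poly_pCons)

lemma of_polynomial_1 [simp]: "of_polynomial 1 = 1"
  by (simp add: one_pCons of_polynomial_pCons)

lemma of_polynomial_add: "of_polynomial (p + r) = of_polynomial p + of_polynomial r"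
  by (induction p r rule: poly_induct2)
     (simp_all add: of_polynomial_pCons fls_plus_const algebra_simps flip: fls_plus_const)

lemma of_polynomial_smult: "of_polynomial (smult a p) = fls_const a * of_polynomial p"
  by (induction p)
     (simp_all add: of_polynomial_pCons algebra_simps flip: fls_const_mult_const)

lemma of_polynomial_mult: "of_polynomial (p * r) = of_polynomial p * of_polynomial r"
  by (induction p)
     (simp_all add: of_polynomial_pCons of_polynomial_add of_polynomial_smult algebra_simps)

lemma fls_nth_of_polynomial:
  "fls_nth (of_polynomial p) k = (if k \<le> 0 then coeff p (nat (- k)) else 0)"
proof (induction p arbitrary: k)
  case (pCons a p)
  have "nat (- k) = Suc (nat (- (k + 1)))" if "k < 0"
    using that by simp
  then show ?case
    using pCons.IH[of "k + 1"]
    by (cases "k < 0"; cases "k = 0")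
       (auto simp: of_polynomial_pCons fls_X_inv_times_conv_shift)
qed simp

lemma fls_abs_of_polynomial:
  fixes p :: "'a::{field,finite} poly"
  assumes "p \<noteq> 0"
  shows "fls_abs (of_polynomial p) = real CARD('a) ^ degree p"
proof -
  have nz: "fls_nth (of_polynomial p) (- int (degree p)) \<noteq> 0"
    using assms by (simp add: fls_nth_of_polynomial)
  have "fls_subdegree (of_polynomial p) = - int (degree p)"
    using nz by (rule fls_subdegree_eqI) (simp add: fls_nth_of_polynomial coeff_eq_0)
  moreover have "of_polynomial p \<noteq> 0"
    using nz by auto
  ultimately show ?thesis
    by (simp add: fls_abs_def)
qed

interpretation poly_vec: module "poly_scale :: 'a::field poly \<Rightarrow> 'a fls ^ 'n \<Rightarrow> 'a fls ^ 'n"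
  by unfold_locales
     (simp_all add: poly_scale_def of_polynomial_add of_polynomial_mult
        vector_add_ldistrib vector_sadd_rdistrib vector_smult_assoc)

end

theory Submission
  imports Defs
begin

text \<open>
  Since \<open>v 1, \<dots>, v d\<close> are independent over the Laurent series field, a lattice vector \<open>u\<close> is
  \<open>\<Sum>i. a i *s v i\<close> with coefficients in that field.  Rounding each \<open>a i\<close> to its polynomial part
  changes \<open>u\<close> by an element of the polynomial span of the \<open>v i\<close>, so the remainder
  \<open>w = \<Sum>i. b i *s v i\<close>, in which \<open>\<bar>b i\<bar> < 1\<close> for all \<open>i\<close>, is again in the lattice, and the claim is
  that \<open>w = 0\<close>.  Suppose not, and let \<open>j\<close> be an index with \<open>b j \<noteq> 0\<close> for which \<open>\<lambda> j\<close> is largest.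
  The ultrametric inequality gives \<open>\<parallel>w\<parallel> < \<lambda> j\<close> strictly; this is where the non-archimedean setting is
  essential, and in \<open>\<real>\<^sup>d\<close> the same argument breaks down.  Now \<open>w\<close> together with all \<open>v i\<close>
  satisfying \<open>\<lambda> i < \<lambda> j\<close> is an independent family of lattice vectors of norm \<open>< \<lambda> j\<close>.  If there are
  \<open>k\<close> such \<open>v i\<close>, the family has \<open>k + 1\<close> members, so \<open>\<lambda> (k + 1) < \<lambda> j\<close>, and by monotonicity at least
  \<open>k + 1\<close> of the successive minima lie below \<open>\<lambda> j\<close>, a contradiction.  This is \<open>remainder_eq_0\<close>.

  To argue with successive minima at all, one needs that they are attained.  This follows
  because norms of nonzero vectors are integral powers of \<open>q\<close>, and those of lattice vectors are
  bounded away from 0: if \<open>u = g p\<close> with \<open>p \<noteq> 0\<close> polynomial, then \<open>p = g\<^sup>-\<^sup>1 u\<close> has norm at least 1.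
\<close>

section \<open>The absolute value and the norm\<close>

lemma card_field_gt_1: "1 < real CARD('a::{field,finite})"
proof -
  have "card {0, 1 :: 'a} \<le> CARD('a)"
    by (intro card_mono) auto
  then show ?thesis
    by simp
qed

lemma fls_abs_nonneg: "0 \<le> fls_abs f"
  by (simp add: fls_abs_def)

lemma fls_abs_pos: "f \<noteq> 0 \<Longrightarrow> 0 < fls_abs f"
  using card_field_gt_1[where 'a='a] by (simp add: fls_abs_def)

lemma fls_abs_mult: "fls_abs (f * g) = fls_abs f * fls_abs g"
  using card_field_gt_1[where 'a='a]
  by (simp add: fls_abs_def power_int_diff power_int_minus field_simps)

lemma fls_abs_add_less:
  assumes "fls_abs f < R" "fls_abs g < R"
  shows "fls_abs (f + g) < R"
proof (cases "f = 0 \<or> g = 0 \<or> f + g = 0")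
  case True
  then show ?thesis
    using assms fls_abs_nonneg[of f] by (auto simp: fls_abs_def)
next
  case False
  then have "min (fls_subdegree f) (fls_subdegree g) \<le> fls_subdegree (f + g)"
    by (intro fls_plus_subdegree) auto
  then have "fls_abs (f + g) \<le> real CARD('a) powi (- min (fls_subdegree f) (fls_subdegree g))"
    using False card_field_gt_1[where 'a='a]
    by (auto simp: fls_abs_def intro!: power_int_increasing)
  also have "\<dots> < R"
    using assms False by (auto simp: fls_abs_def min_def)
  finally show ?thesis .
qed

lemma fls_abs_sum_less:
  assumes "0 < R" "\<And>i. i \<in> A \<Longrightarrow> fls_abs (f i) < R"
  shows "fls_abs (\<Sum>i\<in>A. f i) < R"
  using assms(2)
  by (induction A rule: infinite_finite_induct)
     (auto simp: fls_abs_add_less assms(1) fls_abs_def[of 0])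

text \<open>The polynomial part of \<open>a\<close> is its principal part together with its constant term.\<close>

lemma polynomial_approximation: "\<exists>p. fls_abs (a - of_polynomial p) < 1"
proof
  let ?b = "a - of_polynomial (fls_prpart a + [:fls_nth a 0:])"
  have zero: "fls_nth ?b k = 0" if "k < 1" for k
    using that
    by (cases "k = 0") (auto simp: fls_nth_of_polynomial coeff_pCons split: nat.splits)
  show "fls_abs ?b < 1"
  proof (cases "?b = 0")
    case False
    then have "1 \<le> fls_subdegree ?b"
      using zero nth_fls_subdegree_nonzero by (metis not_less)
    then have "real CARD('a) powi (- fls_subdegree ?b) < real CARD('a) powi 0"
      using card_field_gt_1[where 'a='a] by (intro power_int_strict_increasing) auto
    then show ?thesis
      using False by (simp add: fls_abs_def)
  qed (simp add: fls_abs_def)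
qed

lemma vec_norm_less_iff: "vec_norm v < R \<longleftrightarrow> (\<forall>i. fls_abs (v $ i) < R)"
  by (simp add: vec_norm_def)

lemma fls_abs_le_vec_norm: "fls_abs (v $ i) \<le> vec_norm v"
  by (simp add: vec_norm_def)

lemma vec_norm_pos: "v \<noteq> 0 \<Longrightarrow> 0 < vec_norm v"
  by (metis fls_abs_le_vec_norm fls_abs_pos order_less_le_trans vec_eq_iff zero_index)

lemma vec_norm_eq_power_int:
  fixes v :: "'a::{field,finite} fls ^ 'n"
  assumes "v \<noteq> 0"
  shows "\<exists>m. vec_norm v = real CARD('a) powi m"
proof -
  have "vec_norm v \<in> range (\<lambda>i. fls_abs (v $ i))"
    unfolding vec_norm_def by (intro Max_in) auto
  then show ?thesis
    using vec_norm_pos[OF assms] by (auto simp: fls_abs_def split: if_splits)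
qed

lemma vec_norm_scale_less:
  assumes "fls_abs a < 1" "vec_norm v \<le> R" "0 < R"
  shows "vec_norm (a *s v) < R"
  unfolding vec_norm_less_iff
proof
  fix i
  have le: "fls_abs (v $ i) \<le> R"
    using assms(2) fls_abs_le_vec_norm order_trans by blast
  have "fls_abs a * fls_abs (v $ i) \<le> fls_abs a * R"
    by (intro mult_left_mono le fls_abs_nonneg)
  also have "\<dots> < R"
    using assms by simp
  finally show "fls_abs ((a *s v) $ i) < R"
    by (simp add: fls_abs_mult)
qed

lemma vec_norm_sum_less:
  assumes "0 < R" "\<And>i. i \<in> A \<Longrightarrow> vec_norm (f i) < R"
  shows "vec_norm (\<Sum>i\<in>A. f i) < R"
  using assms unfolding vec_norm_less_iff
  by (auto intro!: fls_abs_sum_less)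

section \<open>Lattices\<close>

lemma lattice_subspace:
  fixes \<Lambda> :: "('a::field fls ^ 'n) set"
  assumes "is_lattice \<Lambda>"
  shows "poly_vec.subspace \<Lambda>"
proof -
  define e :: "'a poly ^ 'n \<Rightarrow> 'a fls ^ 'n" where "e p = (\<chi> i. of_polynomial (p $ i))" for p
  obtain g :: "'a fls ^ 'n ^ 'n" where \<Lambda>: "\<Lambda> = range (\<lambda>p. g *v e p)"
    using assms by (auto simp: is_lattice_def e_def)
  have "e 0 = 0" "\<And>p r. e (p + r) = e p + e r" "\<And>c p. e (c *s p) = of_polynomial c *s e p"
    by (simp_all add: e_def vec_eq_iff of_polynomial_add of_polynomial_mult)
  then have "0 = g *v e 0" "\<And>p r. g *v e p + g *v e r = g *v e (p + r)"
    "\<And>c p. poly_scale c (g *v e p) = g *v e (c *s p)"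
    by (simp_all add: matrix_vector_right_distrib vector_scalar_commute poly_scale_def)
  then show ?thesis
    unfolding poly_vec.subspace_def \<Lambda> by (blast intro: rangeI)
qed

text \<open>
  Recovering \<open>p\<close> from \<open>u = g p\<close> by the inverse matrix shows that a very short \<open>u\<close> forces all
  entries of \<open>p\<close> to have absolute value below 1, which for polynomials means \<open>p = 0\<close>.
\<close>

lemma lattice_norm_bounded_below:
  fixes \<Lambda> :: "('a::{field,finite} fls ^ 'n) set"
  assumes "is_lattice \<Lambda>"
  shows "\<exists>c>0. \<forall>u\<in>\<Lambda>. u \<noteq> 0 \<longrightarrow> c \<le> vec_norm u"
proof -
  define e :: "'a poly ^ 'n \<Rightarrow> 'a fls ^ 'n" where "e p = (\<chi> i. of_polynomial (p $ i))" for p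
  obtain g :: "'a fls ^ 'n ^ 'n" where g: "invertible g" and \<Lambda>: "\<Lambda> = range (\<lambda>p. g *v e p)"
    using assms by (auto simp: is_lattice_def e_def)
  obtain h where h: "h ** g = mat 1"
    using g by (auto simp: invertible_def)
  define C where "C = 1 + (\<Sum>i\<in>UNIV. \<Sum>j\<in>UNIV. fls_abs (h $ i $ j))"
  have C_pos: "0 < C"
    unfolding C_def by (intro add_pos_nonneg sum_nonneg fls_abs_nonneg) simp
  have h_less: "fls_abs (h $ i $ j) < C" for i j
  proof -
    have "fls_abs (h $ i $ j) \<le> (\<Sum>j\<in>UNIV. fls_abs (h $ i $ j))"
      by (rule member_le_sum) (simp_all add: fls_abs_nonneg)
    also have "\<dots> \<le> (\<Sum>i\<in>UNIV. \<Sum>j\<in>UNIV. fls_abs (h $ i $ j))"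
      by (rule member_le_sum) (simp_all add: fls_abs_nonneg sum_nonneg)
    finally show ?thesis
      by (simp add: C_def)
  qed
  have "1 / C \<le> vec_norm u" if u_mem: "u \<in> \<Lambda>" and u_nz: "u \<noteq> 0" for u
  proof (rule ccontr)
    assume "\<not> ?thesis"
    then have small: "fls_abs (u $ j) < 1 / C" for j
      by (meson fls_abs_le_vec_norm not_le order_le_less_trans)
    obtain p where u: "u = g *v e p"
      using u_mem \<Lambda> by blast
    have e_p: "e p = h *v u"
      by (simp add: u matrix_vector_mul_assoc h)
    have "e p \<noteq> 0"
      using u_nz u by auto
    then obtain i where "of_polynomial (p $ i) \<noteq> 0"
      by (auto simp: e_def vec_eq_iff)
    then have "p $ i \<noteq> 0"
      by auto
    then have "1 \<le> fls_abs (e p $ i)"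
      using card_field_gt_1[where 'a='a] by (simp add: e_def fls_abs_of_polynomial)
    moreover have "fls_abs (h $ i $ j * u $ j) < 1" for j
    proof -
      have "fls_abs (h $ i $ j) * fls_abs (u $ j) \<le> C * fls_abs (u $ j)"
        using h_less[of i j] fls_abs_nonneg[of "u $ j"] by (intro mult_right_mono) auto
      also have "\<dots> < 1"
        using small[of j] C_pos by (simp add: field_simps)
      finally show ?thesis
        by (simp add: fls_abs_mult)
    qed
    then have "fls_abs (e p $ i) < 1"
      unfolding e_p matrix_vector_mult_def by (auto intro!: fls_abs_sum_less)
    ultimately show False
      by simp
  qed
  then show ?thesis
    using C_pos by (intro exI[of _ "1 / C"]) auto
qed

section \<open>Successive minima\<close>

lemma power_int_set_has_least:
  fixes q c :: real
  assumes "1 < q" "0 < c" "T \<noteq> {}"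
    and T: "\<And>t. t \<in> T \<Longrightarrow> c \<le> t \<and> (\<exists>m. t = q powi m)"
  shows "\<exists>t\<in>T. \<forall>s\<in>T. t \<le> s"
proof -
  obtain M where "(1 / q) ^ M < c"
    using real_arch_pow_inv[of c "1 / q"] assms by auto
  then have M: "q powi (- int M) < c"
    by (simp add: power_int_minus power_one_over inverse_eq_divide)
  \<comment> \<open>Every exponent exceeds \<open>- M\<close>, so the least element is found by well-ordering of \<open>nat\<close>.\<close>
  have shift: "\<exists>n. t = q powi (int n - int M)" if t: "t \<in> T" for t
  proof -
    obtain m where m: "t = q powi m"
      using T[OF t] by blast
    have "- int M < m"
    proof (rule ccontr)
      assume "\<not> ?thesis"
      then have "q powi m \<le> q powi (- int M)"
        using assms(1) by (intro power_int_increasing) auto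
      then show False
        using M T[OF t] m by linarith
    qed
    then show ?thesis
      by (intro exI[of _ "nat (m + int M)"]) (simp add: m)
  qed
  obtain t where "t \<in> T"
    using \<open>T \<noteq> {}\<close> by blast
  then have "\<exists>n. q powi (int n - int M) \<in> T"
    using shift[of t] by auto
  define n where "n = (LEAST n. q powi (int n - int M) \<in> T)"
  have "q powi (int n - int M) \<in> T"
    unfolding n_def by (rule LeastI_ex) fact
  moreover have "q powi (int n - int M) \<le> s" if s: "s \<in> T" for s
  proof -
    obtain k where k: "s = q powi (int k - int M)"
      using shift[OF s] by blast
    then have "n \<le> k"
      unfolding n_def using s by (intro Least_le) simp
    then show ?thesis
      unfolding k using assms(1) by (intro power_int_increasing) auto
  qed
  ultimately show ?thesis
    by blast
qed

text \<open>
  The minimum defining a successive minimum is attained because the maximal norms of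
  independent \<open>i\<close>-subsets of the lattice are powers of \<open>q\<close> bounded away from 0.  For \<open>i = 0\<close>
  every positive radius qualifies and there is no minimum.
\<close>

lemma succ_min_attained:
  fixes \<Lambda> :: "('a::{field,finite} fls ^ 'n) set"
  assumes \<Lambda>: "is_lattice \<Lambda>" and "0 < i"
    and ex: "B \<subseteq> \<Lambda>" "finite B" "card B = i" "vec.independent B"
  shows "\<exists>S\<subseteq>\<Lambda>. finite S \<and> card S = i \<and> vec.independent S \<and>
           succ_min \<Lambda> i = Max (vec_norm ` S)"
    and "succ_min \<Lambda> i \<le> Max (vec_norm ` B)"
proof -
  define good where
    "good S \<longleftrightarrow> S \<subseteq> \<Lambda> \<and> finite S \<and> card S = i \<and> vec.independent S" for S
  have good_B: "good B"
    using ex by (simp add: good_def)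
  have max_norm: "Max (vec_norm ` S) \<in> vec_norm ` S" if "good S" for S
    using that \<open>0 < i\<close> by (intro Max_in) (auto simp: good_def)
  have witness: "\<exists>u\<in>\<Lambda>. u \<noteq> 0 \<and> Max (vec_norm ` S) = vec_norm u" if "good S" for S
  proof -
    obtain u where u: "u \<in> S" "Max (vec_norm ` S) = vec_norm u"
      using max_norm[OF \<open>good S\<close>] by blast
    moreover have "u \<noteq> 0"
      using u(1) that vec.dependent_zero[of S] by (auto simp: good_def)
    ultimately show ?thesis
      using that by (auto simp: good_def)
  qed
  obtain c where c: "0 < c" "\<And>u. u \<in> \<Lambda> \<Longrightarrow> u \<noteq> 0 \<Longrightarrow> c \<le> vec_norm u"
    using lattice_norm_bounded_below[OF \<Lambda>] by blast
  have "\<exists>t\<in>{Max (vec_norm ` S) | S. good S}. \<forall>s\<in>{Max (vec_norm ` S) | S. good S}. t \<le> s"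
  proof (rule power_int_set_has_least[OF card_field_gt_1[where 'a='a] c(1)])
    show "{Max (vec_norm ` S) | S. good S} \<noteq> {}"
      using good_B by blast
  next
    fix t assume "t \<in> {Max (vec_norm ` S) | S. good S}"
    then obtain u where "u \<in> \<Lambda>" "u \<noteq> 0" "t = vec_norm u"
      using witness by blast
    then show "c \<le> t \<and> (\<exists>m. t = real CARD('a) powi m)"
      using c(2) vec_norm_eq_power_int by blast
  qed
  then obtain S where S: "good S"
    and least: "\<And>S'. good S' \<Longrightarrow> Max (vec_norm ` S) \<le> Max (vec_norm ` S')"
    by blast
  have "succ_min \<Lambda> i = Max (vec_norm ` S)"
    unfolding succ_min_def
  proof (rule Least_equality)
    have "0 < Max (vec_norm ` S)"
      using witness[OF S] vec_norm_pos by metis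
    then show "0 < Max (vec_norm ` S) \<and> (\<exists>S'\<subseteq>\<Lambda>. finite S' \<and> card S' = i \<and>
        vec.independent S' \<and> (\<forall>v\<in>S'. vec_norm v \<le> Max (vec_norm ` S)))"
      using S by (intro conjI exI[of _ S]) (auto simp: good_def)
  next
    fix r
    assume "0 < r \<and> (\<exists>S'\<subseteq>\<Lambda>. finite S' \<and> card S' = i \<and>
        vec.independent S' \<and> (\<forall>v\<in>S'. vec_norm v \<le> r))"
    then obtain S' where S': "good S'" "\<forall>v\<in>S'. vec_norm v \<le> r"
      by (auto simp: good_def)
    then have "Max (vec_norm ` S') \<le> r"
      using max_norm by force
    then show "Max (vec_norm ` S) \<le> r"
      using least[OF S'(1)] by linarith
  qed
  then show "\<exists>S\<subseteq>\<Lambda>. finite S \<and> card S = i \<and> vec.independent S \<and>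
      succ_min \<Lambda> i = Max (vec_norm ` S)" "succ_min \<Lambda> i \<le> Max (vec_norm ` B)"
    using S least[OF good_B] by (auto simp: good_def)
qed

lemma succ_min_mono:
  assumes \<Lambda>: "is_lattice \<Lambda>" and "0 < i" "i \<le> k"
    and ex: "B \<subseteq> \<Lambda>" "finite B" "card B = k" "vec.independent B"
  shows "succ_min \<Lambda> i \<le> succ_min \<Lambda> k"
proof -
  obtain S where S: "S \<subseteq> \<Lambda>" "finite S" "card S = k" "vec.independent S"
    "succ_min \<Lambda> k = Max (vec_norm ` S)"
    using succ_min_attained(1)[OF \<Lambda> _ ex] assms(2,3) by auto
  obtain S' where S': "S' \<subseteq> S" "card S' = i"
    using S(3) \<open>i \<le> k\<close> by (metis obtain_subset_with_card_n)
  have "succ_min \<Lambda> i \<le> Max (vec_norm ` S')"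
    using S S' \<open>0 < i\<close> vec.independent_mono finite_subset
    by (intro succ_min_attained(2)[OF \<Lambda>]) blast+
  also have "\<dots> \<le> Max (vec_norm ` S)"
    using S S' \<open>0 < i\<close> by (intro Max_mono image_mono) auto
  finally show ?thesis
    using S(5) by simp
qed

section \<open>Successive minima vectors form a basis\<close>

text \<open>
  Since several successive minima may coincide, replacing \<open>v j\<close> by the shorter vector \<open>w\<close> in
  \<open>v 1, \<dots>, v j\<close> need not shorten the longest vector.  So \<open>w\<close> is adjoined only to the vectors of
  norm strictly below \<open>\<lambda> j\<close>; it is independent of them because its coefficient at \<open>v j\<close> is nonzero.
\<close>

lemma remainder_eq_0:
  fixes \<Lambda> :: "('a::{field,finite} fls ^ 'n) set"
  assumes \<Lambda>: "is_lattice \<Lambda>" and v: "succ_min_vectors \<Lambda> v"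
    and b: "\<And>i. i \<in> {1..CARD('n)} \<Longrightarrow> fls_abs (b i) < 1"
    and w: "(\<Sum>i = 1..CARD('n). b i *s v i) \<in> \<Lambda>"
  shows "(\<Sum>i = 1..CARD('n). b i *s v i) = 0"
proof (rule ccontr)
  let ?I = "{1..CARD('n)}"
  let ?w = "\<Sum>i\<in>?I. b i *s v i"
  let ?l = "succ_min \<Lambda>"
  have v_mem: "\<And>i. i \<in> ?I \<Longrightarrow> v i \<in> \<Lambda>" and inj: "inj_on v ?I"
    and indep: "vec.independent (v ` ?I)" and norm_v: "\<And>i. i \<in> ?I \<Longrightarrow> vec_norm (v i) = ?l i"
    using v by (auto simp: succ_min_vectors_def)
  assume "?w \<noteq> 0"
  then have "{i\<in>?I. b i \<noteq> 0} \<noteq> {}"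
    by (force intro: sum.neutral)
  then obtain j where j: "j \<in> ?I" "b j \<noteq> 0"
    and j_max: "\<And>i. i \<in> ?I \<Longrightarrow> b i \<noteq> 0 \<Longrightarrow> ?l i \<le> ?l j"
    using ex_is_arg_min_if_finite[of "{i\<in>?I. b i \<noteq> 0}" "\<lambda>i. - ?l i"]
    by (fastforce simp: is_arg_min_linorder)
  have "v j \<noteq> 0"
    using indep j(1) vec.dependent_zero[of "v ` ?I"] by (metis imageI)
  then have l_pos: "0 < ?l j"
    using vec_norm_pos norm_v j(1) by metis
  have w_less: "vec_norm ?w < ?l j"
  proof (rule vec_norm_sum_less[OF l_pos])
    fix i assume i: "i \<in> ?I"
    show "vec_norm (b i *s v i) < ?l j"
    proof (cases "b i = 0")
      case True
      then show ?thesis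
        using l_pos by (simp add: vec_norm_less_iff fls_abs_def)
    next
      case False
      then show ?thesis
        using vec_norm_scale_less b i j_max norm_v l_pos by metis
    qed
  qed
  have w_notin: "?w \<notin> vec.span (v ` (?I - {j}))"
  proof
    assume "?w \<in> vec.span (v ` (?I - {j}))"
    moreover have "(\<Sum>i\<in>?I - {j}. b i *s v i) \<in> vec.span (v ` (?I - {j}))"
      by (intro vec.span_sum vec.span_scale vec.span_base imageI)
    ultimately have "?w - (\<Sum>i\<in>?I - {j}. b i *s v i) \<in> vec.span (v ` (?I - {j}))"
      by (rule vec.span_diff)
    then have "b j *s v j \<in> vec.span (v ` (?I - {j}))"
      using sum.remove[OF finite_atLeastAtMost j(1), of "\<lambda>i. b i *s v i"]
      by (simp del: One_nat_def)
    then have "inverse (b j) *s (b j *s v j) \<in> vec.span (v ` (?I - {j}))"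
      by (rule vec.span_scale)
    then have "v j \<in> vec.span (v ` (?I - {j}))"
      using j(2) by (simp add: vector_smult_assoc)
    moreover have "v ` (?I - {j}) = v ` ?I - {v j}"
      using inj_on_image_set_diff[OF inj, of ?I "{j}"] j(1) by simp
    ultimately show False
      using indep imageI[OF j(1), of v] unfolding vec.dependent_def by metis
  qed
  define A where "A = {i\<in>?I. ?l i < ?l j}"
  define S where "S = insert ?w (v ` A)"
  have A: "A \<subseteq> ?I - {j}" "finite A"
    by (auto simp: A_def)
  have w_notin_A: "?w \<notin> vec.span (v ` A)"
    using w_notin vec.span_mono[OF image_mono[OF A(1)]] by blast
  have S: "S \<subseteq> \<Lambda>" "finite S" "vec.independent S"
  proof -
    show "S \<subseteq> \<Lambda>" "finite S"
      using w v_mem A by (auto simp: S_def)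
    have "vec.independent (v ` A)"
      using indep A(1) by (elim vec.independent_mono) auto
    then show "vec.independent S"
      unfolding S_def using w_notin_A by (intro vec.independent_insertI)
  qed
  have "card (v ` A) = card A"
    using A(1) by (intro card_image inj_on_subset[OF inj]) auto
  moreover have "?w \<notin> v ` A"
    using w_notin_A vec.span_base by blast
  ultimately have card_S: "card S = Suc (card A)"
    using A(2) by (simp add: S_def)
  have "Max (vec_norm ` S) < ?l j"
    using S(2) w_less norm_v by (auto simp: S_def A_def)
  then have less: "?l (Suc (card A)) < ?l j"
    using succ_min_attained(2)[OF \<Lambda> _ S(1,2) card_S S(3)] by simp
  have "card A \<le> card (?I - {j})"
    using A(1) by (intro card_mono) auto
  then have "Suc (card A) \<le> CARD('n)"
    using j(1) by auto
  moreover have "?l i \<le> ?l (Suc (card A))" if "i \<in> {1..Suc (card A)}" for i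
    using that by (intro succ_min_mono[OF \<Lambda> _ _ S(1,2) card_S S(3)]) auto
  ultimately have "{1..Suc (card A)} \<subseteq> A"
    using less by (fastforce simp: A_def)
  then show False
    using card_mono[OF A(2), of "{1..Suc (card A)}"] by simp
qed

theorem lemma1p18:
  fixes \<Lambda> :: "('a::{field,finite} fls ^ 'n) set"
    and v :: "nat \<Rightarrow> 'a fls ^ 'n"
  assumes "CARD('n) \<ge> 2"
    and "is_lattice \<Lambda>"
    and "succ_min_vectors \<Lambda> v"
  shows "\<Lambda> = poly_vec.span (v ` {1..CARD('n)})"
proof
  let ?I = "{1..CARD('n)}"
  have v_mem: "v ` ?I \<subseteq> \<Lambda>" and inj: "inj_on v ?I" and indep: "vec.independent (v ` ?I)"
    using assms(3) by (auto simp: succ_min_vectors_def)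
  have sub: "poly_vec.subspace \<Lambda>"
    using assms(2) by (rule lattice_subspace)
  show span_le: "poly_vec.span (v ` ?I) \<subseteq> \<Lambda>"
    using v_mem sub by (rule poly_vec.span_minimal)
  show "\<Lambda> \<subseteq> poly_vec.span (v ` ?I)"
  proof
    fix u assume u: "u \<in> \<Lambda>"
    have "vec.dim (UNIV :: ('a fls ^ 'n) set) \<le> card (v ` ?I)"
      unfolding vec_dim_card using card_image[OF inj] by simp
    then have "u \<in> vec.span (v ` ?I)"
      using vec.card_ge_dim_independent[OF subset_UNIV indep] by blast
    then obtain c where "u = (\<Sum>x\<in>v ` ?I. c x *s x)"
      by (auto simp: vec.span_finite)
    then have u_eq: "u = (\<Sum>i\<in>?I. c (v i) *s v i)"
      unfolding sum.reindex[OF inj] by (simp add: o_def)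
    have "\<forall>i. \<exists>p. fls_abs (c (v i) - of_polynomial p) < 1"
      by (intro allI polynomial_approximation)
    then obtain p where p: "\<And>i. fls_abs (c (v i) - of_polynomial (p i)) < 1"
      unfolding choice_iff by blast
    define u' where "u' = (\<Sum>i\<in>?I. poly_scale (p i) (v i))"
    have u': "u' \<in> poly_vec.span (v ` ?I)"
      unfolding u'_def
      by (intro poly_vec.span_sum poly_vec.span_scale poly_vec.span_base imageI)
    have diff: "u - u' = (\<Sum>i\<in>?I. (c (v i) - of_polynomial (p i)) *s v i)"
      by (simp add: u_eq u'_def poly_scale_def vec.scale_left_diff_distrib sum_subtractf)
    have "u - u' \<in> \<Lambda>"
      using sub u u' span_le by (blast intro: poly_vec.subspace_diff)
    then have "u - u' = 0"
      unfolding diff by (intro remainder_eq_0[OF assms(2,3)] p)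
    then show "u \<in> poly_vec.span (v ` ?I)"
      using u' by simp
  qed
qed

end
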